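(* Let $\eta,\mu$ be real parameters, $a<b$, $\Delta t>0$, $s\ge1$ and $N_t\ge 1$ integers, and let $a_{ij},b_i$ ($i,j=1,\dots,s$) be real Runge-Kutta coefficients satisfying the symplectic condition $$b_ia_{ij}+b_ja_{ji}=b_ib_j\qquad\text{for all } i,j=1,\dots,s .$$ Let $(u^n,q^n)_{0\le n\le N_t}$ be a sequence of pairs of smooth real-valued functions on $[a,b]$ with periodic boundary conditions such that, for each $0\le n<N_t$, there are smooth functions $U_i,Q_i,k_i,l_i$ ($i=1,\dots,s$) on $[a,b]$ (depending on $n$) with periodic boundary conditions satisfying the QAV-RK scheme $$U_i=u^n+\Delta t\sum_{j=1}^sa_{ij}k_j,\qquad Q_i=q^n+\Delta t\sum_{j=1}^sa_{ij}l_j,$$ $$k_i=\partial_x\left(-\frac{\eta}{6}Q_i-\frac{\eta}{3}U_i^2-\mu^2\partial_{xx}U_i\right),\qquad l_i=2U_ik_i\qquad(i=1,\dots,s),$$ $$u^{n+1}=u^n+\Delta t\sum_{i=1}^sb_ik_i,\qquad q^{n+1}=q^n+\Delta t\sum_{i=1}^sb_il_i .$$ If the consistent initial condition $q^0=\big(u^0\big)^2$ holds, then the original energy is conserved: $$\mathcal{H}^n=\mathcal{H}^0\qquad\text{for all } 0\le n\le N_t,$$ where $\mathcal{H}^n=-\frac{\eta}{6}\big((u^n)^3,1\big)+\frac{\mu^2}{2}\|\partial_xu^n\|^2$.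
   Context: $(f,g)=\int_a^b f g\,\mathrm{d}x$ and $\|f\|=\sqrt{(f,f)}$. "Periodic boundary conditions" means that each function extends to a smooth $(b-a)$-periodic function on $\mathbb{R}$. The scheme is a time semi-discretization (step size $\Delta t$) by an $s$-stage Runge-Kutta method of the system $u_t=\partial_x(-\frac{\eta}{6}q-\frac{\eta}{3}u^2-\mu^2u_{xx})$, $q_t=2uu_t$, which reformulates the Korteweg-de Vries equation $u_t+\eta uu_x+\mu^2u_{xxx}=0$ using the auxiliary variable $q=u^2$. *)

theory Defs
  imports "HOL-Analysis.Analysis"
begin

text \<open>A real function on \<open>[a, b]\<close> is a total function of type \<open>real \<Rightarrow> real\<close> of which only the
  values on \<open>{a..b}\<close> matter; equations between such functions are stated pointwise on \<open>{a..b}\<close>.\<close>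

definition smooth :: "(real \<Rightarrow> real) \<Rightarrow> bool" where
  "smooth g \<longleftrightarrow> (\<forall>n. (deriv ^^ n) g differentiable_on UNIV)"

definition smooth_periodic_on :: "real \<Rightarrow> real \<Rightarrow> (real \<Rightarrow> real) \<Rightarrow> bool" where
  "smooth_periodic_on a b f \<longleftrightarrow>
     (\<exists>g. smooth g \<and> (\<forall>x. g (x + (b - a)) = g x) \<and> (\<forall>x\<in>{a..b}. f x = g x))"

text \<open>The derivative on \<open>[a, b]\<close> is one-sided at the end points, so that it does not
  depend on the values outside the interval.\<close>

definition dx :: "real \<Rightarrow> real \<Rightarrow> (real \<Rightarrow> real) \<Rightarrow> real \<Rightarrow> real" where
  "dx a b f x = vector_derivative f (at x within {a..b})"

definition L2_inner :: "real \<Rightarrow> real \<Rightarrow> (real \<Rightarrow> real) \<Rightarrow> (real \<Rightarrow> real) \<Rightarrow> real" where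
  "L2_inner a b f g = integral {a..b} (\<lambda>x. f x * g x)"

definition L2_nrm :: "real \<Rightarrow> real \<Rightarrow> (real \<Rightarrow> real) \<Rightarrow> real" where
  "L2_nrm a b f = sqrt (L2_inner a b f f)"

definition kdv_energy :: "real \<Rightarrow> real \<Rightarrow> real \<Rightarrow> real \<Rightarrow> (real \<Rightarrow> real) \<Rightarrow> real" where
  "kdv_energy a b \<eta> \<mu> u =
     - \<eta> / 6 * L2_inner a b (\<lambda>x. u x ^ 3) (\<lambda>x. 1) + \<mu>\<^sup>2 / 2 * (L2_nrm a b (dx a b u))\<^sup>2"

definition symplectic_rk :: "nat \<Rightarrow> (nat \<Rightarrow> nat \<Rightarrow> real) \<Rightarrow> (nat \<Rightarrow> real) \<Rightarrow> bool" where
  "symplectic_rk s A w \<longleftrightarrow>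
     (\<forall>i\<in>{1..s}. \<forall>j\<in>{1..s}. w i * A i j + w j * A j i = w i * w j)"

text \<open>One time step from \<open>(u, q)\<close> to \<open>(u', q')\<close> with step size \<open>\<tau>\<close> and the \<open>s\<close>-stage
  Runge--Kutta method with matrix \<open>A\<close> and weights \<open>w\<close>.\<close>

definition qav_rk_step ::
  "real \<Rightarrow> real \<Rightarrow> real \<Rightarrow> real \<Rightarrow> real \<Rightarrow> nat \<Rightarrow> (nat \<Rightarrow> nat \<Rightarrow> real) \<Rightarrow> (nat \<Rightarrow> real) \<Rightarrow>
   (real \<Rightarrow> real) \<Rightarrow> (real \<Rightarrow> real) \<Rightarrow> (real \<Rightarrow> real) \<Rightarrow> (real \<Rightarrow> real) \<Rightarrow> bool" where
  "qav_rk_step a b \<eta> \<mu> \<tau> s A w u q u' q' \<longleftrightarrow>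
     (\<exists>U Q k l :: nat \<Rightarrow> real \<Rightarrow> real.
        (\<forall>i\<in>{1..s}. smooth_periodic_on a b (U i) \<and> smooth_periodic_on a b (Q i) \<and>
                    smooth_periodic_on a b (k i) \<and> smooth_periodic_on a b (l i)) \<and>
        (\<forall>i\<in>{1..s}. \<forall>x\<in>{a..b}.
           U i x = u x + \<tau> * (\<Sum>j=1..s. A i j * k j x) \<and>
           Q i x = q x + \<tau> * (\<Sum>j=1..s. A i j * l j x) \<and>
           k i x = dx a b (\<lambda>y. - \<eta> / 6 * Q i y - \<eta> / 3 * (U i y)\<^sup>2
                                - \<mu>\<^sup>2 * dx a b (dx a b (U i)) y) x \<and>
           l i x = 2 * U i x * k i x) \<and>
        (\<forall>x\<in>{a..b}.
           u' x = u x + \<tau> * (\<Sum>i=1..s. w i * k i x) \<and>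
           q' x = q x + \<tau> * (\<Sum>i=1..s. w i * l i x)))"

end

theory Submission
  imports Defs
begin

text \<open>A symplectic Runge--Kutta method preserves bilinear identities exactly. Applied pointwise to
  \<open>u\<^sup>2\<close> this propagates the constraint \<open>q = u\<^sup>2\<close>, so the energy density may be read as the quadratic
  expression \<open>- \<eta>/6 u q + \<mu>\<^sup>2/2 u\<^sub>x\<^sup>2\<close>. Applied to \<open>u q\<close> and \<open>u\<^sub>x\<^sup>2\<close>, it shows that the density changes
  in one step by \<open>\<tau> \<Sum> w\<^sub>i (F\<^sub>i k\<^sub>i + \<mu>\<^sup>2 (U\<^sub>i\<^sub>x\<^sub>x k\<^sub>i + U\<^sub>i\<^sub>x k\<^sub>i\<^sub>x))\<close>, where
  \<open>F\<^sub>i = - \<eta>/6 Q\<^sub>i - \<eta>/3 U\<^sub>i\<^sup>2 - \<mu>\<^sup>2 U\<^sub>i\<^sub>x\<^sub>x\<close>. Since \<open>k\<^sub>i = F\<^sub>i\<^sub>x\<close>, this is the derivative of the periodic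
  function \<open>\<tau> \<Sum> w\<^sub>i (F\<^sub>i\<^sup>2/2 + \<mu>\<^sup>2 U\<^sub>i\<^sub>x k\<^sub>i)\<close>, whose integral over a period vanishes.\<close>

text \<open>Expanding the left side leaves the second order term
  \<open>\<tau>\<^sup>2 w\<^sub>i w\<^sub>j k\<^sub>i l\<^sub>j\<close>, summed over
  \<open>i\<close> and \<open>j\<close>. The symplectic condition splits \<open>w i * w j\<close>
  into \<open>w i * A i j + w j * A j i\<close>. After exchanging the indices in the second half,
  these are exactly the second order terms that \<open>U i\<close> and \<open>V i\<close> contribute
  on the right.\<close>

lemma symplectic_rk_mult:
  fixes u v \<tau> :: real and k l U V :: "nat \<Rightarrow> real"
  assumes "symplectic_rk s A w"
    and U: "\<And>i. i \<in> {1..s} \<Longrightarrow> U i = u + \<tau> * (\<Sum>j=1..s. A i j * k j)"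
    and V: "\<And>i. i \<in> {1..s} \<Longrightarrow> V i = v + \<tau> * (\<Sum>j=1..s. A i j * l j)"
  shows "(u + \<tau> * (\<Sum>i=1..s. w i * k i)) * (v + \<tau> * (\<Sum>i=1..s. w i * l i)) =
         u * v + \<tau> * (\<Sum>i=1..s. w i * (k i * V i + U i * l i))"
proof -
  let ?S = "\<lambda>f. \<Sum>i=1..s. \<Sum>j=1..s. f i j :: real"
  have "(\<Sum>i=1..s. w i * k i) * (\<Sum>i=1..s. w i * l i) = ?S (\<lambda>i j. w i * w j * (k i * l j))"
    unfolding sum_product by (intro sum.cong refl) simp
  also have "\<dots> = ?S (\<lambda>i j. w i * A i j * (k i * l j) + w j * A j i * (k i * l j))"
    using assms(1) unfolding symplectic_rk_def
    by (intro sum.cong refl) (metis distrib_right)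
  also have "\<dots> = ?S (\<lambda>i j. w i * A i j * (k i * l j)) + ?S (\<lambda>i j. w j * A j i * (k i * l j))"
    by (simp add: sum.distrib)
  also have "?S (\<lambda>i j. w j * A j i * (k i * l j)) = ?S (\<lambda>i j. w i * A i j * (k j * l i))"
    by (rule sum.swap)
  finally have prod: "(\<Sum>i=1..s. w i * k i) * (\<Sum>i=1..s. w i * l i) =
      ?S (\<lambda>i j. w i * A i j * (k i * l j)) + ?S (\<lambda>i j. w i * A i j * (k j * l i))" .
  have "(\<Sum>i=1..s. w i * (k i * V i + U i * l i)) =
      (\<Sum>i=1..s. v * (w i * k i) + u * (w i * l i)
        + \<tau> * (\<Sum>j=1..s. w i * A i j * (k i * l j)) + \<tau> * (\<Sum>j=1..s. w i * A i j * (k j * l i)))"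
    by (intro sum.cong refl) (simp add: U V algebra_simps sum_distrib_left)
  also have "\<dots> = v * (\<Sum>i=1..s. w i * k i) + u * (\<Sum>i=1..s. w i * l i)
      + \<tau> * ((\<Sum>i=1..s. w i * k i) * (\<Sum>i=1..s. w i * l i))"
    unfolding prod by (simp add: sum.distrib sum_distrib_left distrib_left)
  finally show ?thesis
    by (simp add: algebra_simps)
qed

lemma dx_unique:
  assumes "a < b" "x \<in> {a..b}" "(f has_real_derivative d) (at x within {a..b})"
  shows "dx a b f x = d"
  using assms vector_derivative_within_cbox[of a b x f d]
  by (simp add: dx_def cbox_interval has_real_derivative_iff_has_vector_derivative)

lemma smooth_has_derivative:
  assumes "smooth g"
  shows "(g has_real_derivative deriv g x) (at x)"
proof -
  have "g differentiable (at x)"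
    using assms unfolding smooth_def differentiable_on_def by (metis UNIV_I funpow_0)
  then show ?thesis
    by (simp add: DERIV_deriv_iff_real_differentiable)
qed

lemma smooth_deriv: "smooth g \<Longrightarrow> smooth (deriv g)"
  unfolding smooth_def by (metis comp_apply funpow_Suc_right)

text \<open>Both claims are inherited from the periodic extension \<open>g\<close>: on
  \<open>{a..b}\<close> the one-sided derivative of \<open>f\<close> is \<open>deriv g\<close>, and
  \<open>deriv g\<close> is periodic because \<open>g\<close> and its shift by \<open>b - a\<close>
  are the same function.\<close>

lemma smooth_periodic_on_dx:
  assumes "a < b" "smooth_periodic_on a b f"
  shows smooth_periodic_on_has_dx:
      "x \<in> {a..b} \<Longrightarrow> (f has_real_derivative dx a b f x) (at x within {a..b})"
    and "smooth_periodic_on a b (dx a b f)"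
proof -
  from assms obtain g where g: "smooth g" "\<And>x. g (x + (b - a)) = g x"
    "\<And>x. x \<in> {a..b} \<Longrightarrow> f x = g x"
    unfolding smooth_periodic_on_def by blast
  have der: "(f has_real_derivative deriv g x) (at x within {a..b})" if "x \<in> {a..b}" for x
    using has_field_derivative_at_within[OF smooth_has_derivative[OF g(1)]]
    by (rule has_field_derivative_transform_within[OF _ zero_less_one that]) (simp add: g(3))
  show "(f has_real_derivative dx a b f x) (at x within {a..b})" if "x \<in> {a..b}"
    using der[OF that] dx_unique[OF assms(1) that der[OF that]] by simp
  have "deriv g (x + (b - a)) = deriv g x" for x
  proof -
    have "((\<lambda>x. g (x + (b - a))) has_real_derivative deriv g (x + (b - a))) (at x)"
      by (rule DERIV_shift[THEN iffD1, OF smooth_has_derivative[OF g(1)]])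
    then show ?thesis
      unfolding g(2) using smooth_has_derivative[OF g(1)] by (rule DERIV_unique)
  qed
  then show "smooth_periodic_on a b (dx a b f)"
    unfolding smooth_periodic_on_def
    using smooth_deriv[OF g(1)] dx_unique[OF assms(1) _ der] by blast
qed

lemma smooth_periodic_on_endpoints:
  assumes "a < b" "smooth_periodic_on a b f"
  shows "f b = f a"
  using assms unfolding smooth_periodic_on_def
  by (metis add.commute atLeastAtMost_iff diff_add_cancel less_imp_le order_refl)

lemma smooth_periodic_on_continuous:
  assumes "a < b" "smooth_periodic_on a b f"
  shows "continuous_on {a..b} f"
  using smooth_periodic_on_has_dx[OF assms] DERIV_continuous_on by blast

lemma kdv_energy_eq_integral:
  assumes "a < b" "smooth_periodic_on a b u"
  shows "kdv_energy a b \<eta> \<mu> u =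
      integral {a..b} (\<lambda>x. - \<eta> / 6 * u x ^ 3 + \<mu>\<^sup>2 / 2 * (dx a b u x)\<^sup>2)"
    and "(\<lambda>x. - \<eta> / 6 * u x ^ 3 + \<mu>\<^sup>2 / 2 * (dx a b u x)\<^sup>2) integrable_on {a..b}"
proof -
  note cont = smooth_periodic_on_continuous[OF assms]
    smooth_periodic_on_continuous[OF assms(1) smooth_periodic_on_dx(2)[OF assms]]
  have int: "(\<lambda>x. u x ^ 3) integrable_on {a..b}" "(\<lambda>x. (dx a b u x)\<^sup>2) integrable_on {a..b}"
    by (intro integrable_continuous_real continuous_intros cont)+
  show "(\<lambda>x. - \<eta> / 6 * u x ^ 3 + \<mu>\<^sup>2 / 2 * (dx a b u x)\<^sup>2) integrable_on {a..b}"
    by (intro integrable_continuous_real continuous_intros cont)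
  \<comment> \<open>Nonnegativity lets the square cancel the square root in
    \<open>L2_nrm\<close>.\<close>
  have "0 \<le> integral {a..b} (\<lambda>x. (dx a b u x)\<^sup>2)"
    by (intro integral_nonneg int) simp
  then have "(L2_nrm a b (dx a b u))\<^sup>2 = integral {a..b} (\<lambda>x. (dx a b u x)\<^sup>2)"
    by (simp add: L2_nrm_def L2_inner_def power2_eq_square)
  moreover have "integral {a..b} (\<lambda>x. - \<eta> / 6 * u x ^ 3 + \<mu>\<^sup>2 / 2 * (dx a b u x)\<^sup>2) =
      integral {a..b} (\<lambda>x. - \<eta> / 6 * u x ^ 3) + integral {a..b} (\<lambda>x. \<mu>\<^sup>2 / 2 * (dx a b u x)\<^sup>2)"
    using int by (intro integral_add integrable_on_mult_right)
  ultimately show "kdv_energy a b \<eta> \<mu> u =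
      integral {a..b} (\<lambda>x. - \<eta> / 6 * u x ^ 3 + \<mu>\<^sup>2 / 2 * (dx a b u x)\<^sup>2)"
    by (simp add: kdv_energy_def L2_inner_def)
qed

text \<open>This is \<open>symplectic_rk_mult\<close> with both factors equal to \<open>u\<close>:
  the slope of the square at stage \<open>i\<close> is then \<open>2 * U i x * k i x\<close>, which
  is how the scheme defines \<open>l i x\<close>.\<close>

lemma qav_rk_step_constraint:
  assumes "symplectic_rk s A w" "qav_rk_step a b \<eta> \<mu> \<tau> s A w u q u' q'"
    and "\<And>x. x \<in> {a..b} \<Longrightarrow> q x = (u x)\<^sup>2" and x: "x \<in> {a..b}"
  shows "q' x = (u' x)\<^sup>2"
proof -
  from assms(2) x obtain U k l where
    stage: "\<And>i. i \<in> {1..s} \<Longrightarrow> U i x = u x + \<tau> * (\<Sum>j=1..s. A i j * k j x)"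
      "\<And>i. i \<in> {1..s} \<Longrightarrow> l i x = 2 * U i x * k i x"
    and upd: "u' x = u x + \<tau> * (\<Sum>i=1..s. w i * k i x)"
      "q' x = q x + \<tau> * (\<Sum>i=1..s. w i * l i x)"
    unfolding qav_rk_step_def by blast
  have "(u' x)\<^sup>2 = u x * u x + \<tau> * (\<Sum>i=1..s. w i * (k i x * U i x + U i x * k i x))"
    unfolding upd power2_eq_square
    by (rule symplectic_rk_mult[OF assms(1), where U="\<lambda>i. U i x" and V="\<lambda>i. U i x"])
      (use stage in auto)
  also have "(\<Sum>i=1..s. w i * (k i x * U i x + U i x * k i x)) = (\<Sum>i=1..s. w i * l i x)"
    by (intro sum.cong refl) (simp add: stage)
  finally show ?thesis
    using upd(2) assms(3)[OF x] by (simp add: power2_eq_square)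
qed

lemma qav_rk_step_energy:
  assumes ab: "a < b" and sym: "symplectic_rk s A w"
    and step: "qav_rk_step a b \<eta> \<mu> \<tau> s A w u q u' q'"
    and u: "smooth_periodic_on a b u" and u': "smooth_periodic_on a b u'"
    and q: "\<And>x. x \<in> {a..b} \<Longrightarrow> q x = (u x)\<^sup>2"
  shows "kdv_energy a b \<eta> \<mu> u' = kdv_energy a b \<eta> \<mu> u"
proof -
  define F where "F U Q = (\<lambda>y. - \<eta> / 6 * Q y - \<eta> / 3 * (U y)\<^sup>2
    - \<mu>\<^sup>2 * dx a b (dx a b U) y)" for U Q :: "real \<Rightarrow> real"
  from step obtain U Q k l where
    per: "\<And>i. i \<in> {1..s} \<Longrightarrow> smooth_periodic_on a b (U i)"
      "\<And>i. i \<in> {1..s} \<Longrightarrow> smooth_periodic_on a b (Q i)"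
      "\<And>i. i \<in> {1..s} \<Longrightarrow> smooth_periodic_on a b (k i)"
    and stage:
      "\<And>i x. i \<in> {1..s} \<Longrightarrow> x \<in> {a..b} \<Longrightarrow> U i x = u x + \<tau> * (\<Sum>j=1..s. A i j * k j x)"
      "\<And>i x. i \<in> {1..s} \<Longrightarrow> x \<in> {a..b} \<Longrightarrow> Q i x = q x + \<tau> * (\<Sum>j=1..s. A i j * l j x)"
      "\<And>i x. i \<in> {1..s} \<Longrightarrow> x \<in> {a..b} \<Longrightarrow> k i x = dx a b (F (U i) (Q i)) x"
      "\<And>i x. i \<in> {1..s} \<Longrightarrow> x \<in> {a..b} \<Longrightarrow> l i x = 2 * U i x * k i x"
    and upd: "\<And>x. x \<in> {a..b} \<Longrightarrow> u' x = u x + \<tau> * (\<Sum>i=1..s. w i * k i x)"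
      "\<And>x. x \<in> {a..b} \<Longrightarrow> q' x = q x + \<tau> * (\<Sum>i=1..s. w i * l i x)"
    unfolding qav_rk_step_def F_def by blast
  note D = smooth_periodic_on_has_dx[OF ab]
  note P = smooth_periodic_on_dx(2)[OF ab]
  note E = smooth_periodic_on_endpoints[OF ab]

  \<comment> \<open>The scheme gives \<open>k i x\<close> only as the value of \<open>dx\<close>,
    which does not assert differentiability. The flux is first differentiated by the usual rules,
    using smoothness of the stages; uniqueness then identifies the result with
    \<open>k i x\<close>.\<close>
  have derF: "(F (U i) (Q i) has_real_derivative k i x) (at x within {a..b})"
    if i: "i \<in> {1..s}" and x: "x \<in> {a..b}" for i x
  proof -
    have "(F (U i) (Q i) has_real_derivative - \<eta> / 6 * dx a b (Q i) x
        - \<eta> / 3 * (2 * U i x * dx a b (U i) x)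
        - \<mu>\<^sup>2 * dx a b (dx a b (dx a b (U i))) x) (at x within {a..b})"
      unfolding F_def power2_eq_square
      by (auto intro!: derivative_eq_intros D[OF per(1)[OF i] x] D[OF per(2)[OF i] x]
          D[OF P[OF P[OF per(1)[OF i]]] x])
    then show ?thesis
      using dx_unique[OF ab x] stage(3)[OF i x] by simp
  qed
  have F_end: "F (U i) (Q i) b = F (U i) (Q i) a" if "i \<in> {1..s}" for i
    using E[OF per(1)] E[OF per(2)] E[OF P[OF P[OF per(1)]]] that by (simp add: F_def)

  \<comment> \<open>Differentiating the stage equations in space shows that the
    \<open>dx a b (U i)\<close> are stages of the same Runge-Kutta method with slopes
    \<open>dx a b (k i)\<close>, so \<open>symplectic_rk_mult\<close> also applies to the squared
    derivative.\<close>
  have dxU: "dx a b (U i) x = dx a b u x + \<tau> * (\<Sum>j=1..s. A i j * dx a b (k j) x)"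
    if i: "i \<in> {1..s}" and x: "x \<in> {a..b}" for i x
  proof (rule dx_unique[OF ab x])
    have "((\<lambda>x. u x + \<tau> * (\<Sum>j=1..s. A i j * k j x)) has_real_derivative
        dx a b u x + \<tau> * (\<Sum>j=1..s. A i j * dx a b (k j) x)) (at x within {a..b})"
      by (intro DERIV_add DERIV_cmult DERIV_sum D u per x)
    then show "(U i has_real_derivative
        dx a b u x + \<tau> * (\<Sum>j=1..s. A i j * dx a b (k j) x)) (at x within {a..b})"
      by (rule has_field_derivative_transform_within[OF _ zero_less_one x])
        (rule stage(1)[OF i, symmetric])
  qed
  have dxu': "dx a b u' x = dx a b u x + \<tau> * (\<Sum>j=1..s. w j * dx a b (k j) x)"
    if x: "x \<in> {a..b}" for x
  proof (rule dx_unique[OF ab x])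
    have "((\<lambda>x. u x + \<tau> * (\<Sum>j=1..s. w j * k j x)) has_real_derivative
        dx a b u x + \<tau> * (\<Sum>j=1..s. w j * dx a b (k j) x)) (at x within {a..b})"
      by (intro DERIV_add DERIV_cmult DERIV_sum D u per x)
    then show "(u' has_real_derivative
        dx a b u x + \<tau> * (\<Sum>j=1..s. w j * dx a b (k j) x)) (at x within {a..b})"
      by (rule has_field_derivative_transform_within[OF _ zero_less_one x]) (simp add: upd(1))
  qed

  \<comment> \<open>\<open>e\<close> is the energy density, \<open>g\<close> its change over the
    step and \<open>G\<close> an antiderivative of \<open>g\<close>.\<close>
  define G where "G x = \<tau> * (\<Sum>i=1..s. w i * ((F (U i) (Q i) x)\<^sup>2 / 2
    + \<mu>\<^sup>2 * (dx a b (U i) x * k i x)))" for x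
  define g where "g x = \<tau> * (\<Sum>i=1..s. w i * (F (U i) (Q i) x * k i x
    + \<mu>\<^sup>2 * (dx a b (dx a b (U i)) x * k i x + dx a b (U i) x * dx a b (k i) x)))" for x
  define e where "e v x = - \<eta> / 6 * v x ^ 3 + \<mu>\<^sup>2 / 2 * (dx a b v x)\<^sup>2"
    for v :: "real \<Rightarrow> real" and x
  have change: "e u' x - e u x = g x" if x: "x \<in> {a..b}" for x
  proof -
    \<comment> \<open>The constraint holds at both ends of the step, so each cube is the bilinear
      product of \<open>u\<close> and \<open>q\<close>, to which the multiplication identity
      applies.\<close>
    have cube: "u' x ^ 3 - u x ^ 3 = \<tau> * (\<Sum>i=1..s. w i * (k i x * Q i x + U i x * l i x))"
    proof -
      have "u' x * q' x = u x * q x + \<tau> * (\<Sum>i=1..s. w i * (k i x * Q i x + U i x * l i x))"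
        unfolding upd(1)[OF x] upd(2)[OF x]
        by (rule symplectic_rk_mult[OF sym, where U="\<lambda>i. U i x" and V="\<lambda>i. Q i x"])
          (use stage x in auto)
      then show ?thesis
        using q[OF x] qav_rk_step_constraint[OF sym step q x]
        by (simp add: power2_eq_square power3_eq_cube mult.assoc)
    qed
    have square: "(dx a b u' x)\<^sup>2 - (dx a b u x)\<^sup>2 =
        \<tau> * (\<Sum>i=1..s. w i * (dx a b (k i) x * dx a b (U i) x + dx a b (U i) x * dx a b (k i) x))"
    proof -
      have "dx a b u' x * dx a b u' x = dx a b u x * dx a b u x +
          \<tau> * (\<Sum>i=1..s. w i * (dx a b (k i) x * dx a b (U i) x + dx a b (U i) x * dx a b (k i) x))"
        unfolding dxu'[OF x]
        by (rule symplectic_rk_mult[OF sym, where U="\<lambda>i. dx a b (U i) x"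
            and V="\<lambda>i. dx a b (U i) x"]) (use dxU x in auto)
      then show ?thesis
        by (simp add: power2_eq_square)
    qed
    have "e u' x - e u x = - \<eta> / 6 * (u' x ^ 3 - u x ^ 3)
        + \<mu>\<^sup>2 / 2 * ((dx a b u' x)\<^sup>2 - (dx a b u x)\<^sup>2)"
      by (simp add: e_def algebra_simps)
    also have "\<dots> = \<tau> * (\<Sum>i=1..s. - \<eta> / 6 * (w i * (k i x * Q i x + U i x * l i x))
        + \<mu>\<^sup>2 / 2 * (w i * (dx a b (k i) x * dx a b (U i) x + dx a b (U i) x * dx a b (k i) x)))"
      unfolding cube square sum.distrib sum_distrib_left[symmetric] by (simp add: algebra_simps)
    also have "\<dots> = g x"
      unfolding g_def
    proof (intro arg_cong[where f="(*) \<tau>"] sum.cong refl)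
      fix i assume i: "i \<in> {1..s}"
      show "- \<eta> / 6 * (w i * (k i x * Q i x + U i x * l i x)) + \<mu>\<^sup>2 / 2 *
          (w i * (dx a b (k i) x * dx a b (U i) x + dx a b (U i) x * dx a b (k i) x)) =
        w i * (F (U i) (Q i) x * k i x + \<mu>\<^sup>2 * (dx a b (dx a b (U i)) x * k i x
          + dx a b (U i) x * dx a b (k i) x))"
        \<comment> \<open>Inserting \<open>l\<^sub>i = 2 U\<^sub>i k\<^sub>i\<close> turns the cubic
          part into \<open>(- \<eta>/6 Q\<^sub>i - \<eta>/3 U\<^sub>i\<^sup>2) k\<^sub>i\<close>,
          which is the flux times \<open>k\<^sub>i\<close> plus
          \<open>\<mu>\<^sup>2 U\<^sub>i\<^sub>x\<^sub>x k\<^sub>i\<close>.\<close>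
        unfolding stage(4)[OF i x] F_def by (simp add: field_simps power2_eq_square)
    qed
    finally show ?thesis .
  qed
  have "(g has_integral G b - G a) {a..b}"
  proof (rule fundamental_theorem_of_calculus)
    fix x assume x: "x \<in> {a..b}"
    have "((\<lambda>x. (F (U i) (Q i) x)\<^sup>2 / 2 + \<mu>\<^sup>2 * (dx a b (U i) x * k i x)) has_real_derivative
        F (U i) (Q i) x * k i x + \<mu>\<^sup>2 * (dx a b (dx a b (U i)) x * k i x
          + dx a b (U i) x * dx a b (k i) x)) (at x within {a..b})"
      if i: "i \<in> {1..s}" for i
      unfolding power2_eq_square
      by (auto intro!: derivative_eq_intros derF[OF i x] D[OF per(3)[OF i] x]
          D[OF P[OF per(1)[OF i]] x])
    then have "(G has_real_derivative g x) (at x within {a..b})"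
      unfolding G_def g_def by (intro DERIV_cmult DERIV_sum)
    then show "(G has_vector_derivative g x) (at x within {a..b})"
      by (simp add: has_real_derivative_iff_has_vector_derivative)
  qed (use ab in simp)
  moreover have "G b = G a"
    unfolding G_def
    by (intro arg_cong[where f="(*) \<tau>"] sum.cong refl)
      (simp add: F_end E[OF per(3)] E[OF P[OF per(1)]])
  ultimately have "integral {a..b} g = 0"
    by (simp add: integral_unique)
  moreover have "integral {a..b} (\<lambda>x. e u' x - e u x) = integral {a..b} g"
    by (intro integral_cong change)
  ultimately show ?thesis
    using kdv_energy_eq_integral[OF ab u, of \<eta> \<mu>] kdv_energy_eq_integral[OF ab u', of \<eta> \<mu>]
    by (simp add: e_def integral_diff)
qed

theorem theorem3p2:
  fixes a b \<eta> \<mu> \<tau> :: real and s N :: nat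
    and A :: "nat \<Rightarrow> nat \<Rightarrow> real" and w :: "nat \<Rightarrow> real"
    and u q :: "nat \<Rightarrow> real \<Rightarrow> real"
  assumes "a < b" and "\<tau> > 0" and "s \<ge> 1" and "N \<ge> 1"
    and "symplectic_rk s A w"
    and "\<And>n. n \<le> N \<Longrightarrow> smooth_periodic_on a b (u n) \<and> smooth_periodic_on a b (q n)"
    and "\<And>n. n < N \<Longrightarrow> qav_rk_step a b \<eta> \<mu> \<tau> s A w (u n) (q n) (u (Suc n)) (q (Suc n))"
    and "\<And>x. x \<in> {a..b} \<Longrightarrow> q 0 x = (u 0 x)\<^sup>2"
  shows "\<forall>n\<le>N. kdv_energy a b \<eta> \<mu> (u n) = kdv_energy a b \<eta> \<mu> (u 0)"
proof -
  \<comment> \<open>The induction carries the constraint along with the energy, since the energy is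
    compared across a step only when the constraint holds at its start.\<close>
  have "(\<forall>x\<in>{a..b}. q n x = (u n x)\<^sup>2) \<and> kdv_energy a b \<eta> \<mu> (u n) = kdv_energy a b \<eta> \<mu> (u 0)"
    if "n \<le> N" for n
    using that
  proof (induction n)
    case 0
    then show ?case
      using assms(8) by simp
  next
    case (Suc n)
    then have IH: "\<And>x. x \<in> {a..b} \<Longrightarrow> q n x = (u n x)\<^sup>2"
      "kdv_energy a b \<eta> \<mu> (u n) = kdv_energy a b \<eta> \<mu> (u 0)"
      by simp_all
    have step: "qav_rk_step a b \<eta> \<mu> \<tau> s A w (u n) (q n) (u (Suc n)) (q (Suc n))"
      using assms(7) Suc.prems by simp
    have "q (Suc n) x = (u (Suc n) x)\<^sup>2" if "x \<in> {a..b}" for x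
      using qav_rk_step_constraint[OF assms(5) step IH(1) that] .
    moreover have "kdv_energy a b \<eta> \<mu> (u (Suc n)) = kdv_energy a b \<eta> \<mu> (u n)"
      using assms(6) Suc.prems by (intro qav_rk_step_energy[OF assms(1,5) step _ _ IH(1)]) simp_all
    ultimately show ?case
      using IH(2) by simp
  qed
  then show ?thesis
    by blast
qed

end
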